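(* Let $1 \le \ell < r$ be integers. For any family $\mathcal{F}$ of nonempty $r$-graphs, $\pi^{\star}_{\ell}(\mathcal{F}) = \pi_{\ell}(\mathcal{F})$.
   Context: For a set $A$, $A^{(r)}$ denotes the collection of all $r$-subsets of $A$. An $r$-graph is a pair $G=(V,E)$ with $V=V(G)$ a finite set of vertices and $E=E(G)\subseteq V^{(r)}$; $v(G)=|V(G)|$; $G$ is nonempty if it has at least one edge. A subgraph of $G$ is an $r$-graph $H$ with $V(H)\subseteq V(G)$ and $E(H)\subseteq E(G)$. $G$ is $\mathcal{F}$-free if it does not contain a copy of a member of $\mathcal{F}$ as a (not necessarily induced) subgraph. For $S\in V(G)^{(\ell)}$, $\deg(S)$ is the number of edges of $G$ containing $S$, and $\delta_\ell(G)$ is the minimum of $\deg(S)$ over all $S\in V(G)^{(\ell)}$. The Turán $\ell$-degree threshold $\mathrm{ex}_\ell(n,\mathcal{F})$ is the maximum of $\delta_\ell(G)$ over all $\mathcal{F}$-free $r$-graphs $G$ on $n$ vertices, and the Turán $\ell$-degree density is $\pi_\ell(\mathcal{F})=\lim_{n\to\infty}\mathrm{ex}_\ell(n,\mathcal{F})/\binom{n-\ell}{r-\ell}$ (this limit is known to exist). For $\varepsilon>0$, $\delta_\ell^{\varepsilon}(G)$ is the largest integer $d$ such that all but at most $\varepsilon\binom{v(G)}{\ell}$ of the $\ell$-subsets $S\in V(G)^{(\ell)}$ satisfy $\deg(S)\ge d$ (the same definition is used for $\varepsilon=0$). A sequence $\mathbf{G}=(G_n)_{n\in\mathbb{N}}$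 of $r$-graphs is an $(r,\ell)$-sequence if (i) $v(G_n)\to\infty$ as $n\to\infty$, and (ii) there are a constant $p\in[0,1]$ and a sequence of nonnegative reals $\varepsilon_n\to 0$ such that $\delta_\ell^{\varepsilon_n}(G_n)\ge p\binom{v(G_n)-\ell}{r-\ell}$ for each $n$. The density $\rho(\mathbf{G})$ of the sequence is the supremum of all $p\ge 0$ for which (ii) is satisfied. Finally, $$\pi^\star_\ell(\mathcal{F})=\sup\{\rho(\mathbf{G}) : \mathbf{G}\text{ is an }(r,\ell)\text{-sequence of }\mathcal{F}\text{-free } r\text{-graphs}\}.$$ *)

theory Defs
  imports Complex_Main "HOL-Library.Ramsey" "HOL-Library.Extended_Real"
begin

record 'a hypergraph =
  verts :: "'a set"
  edges :: "'a set set"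

definition rgraph :: "nat \<Rightarrow> 'a hypergraph \<Rightarrow> bool" where
  "rgraph r G \<longleftrightarrow> finite (verts G) \<and> edges G \<subseteq> nsets (verts G) r"

definition subgraph :: "nat \<Rightarrow> 'a hypergraph \<Rightarrow> 'a hypergraph \<Rightarrow> bool" where
  "subgraph r H G \<longleftrightarrow> rgraph r H \<and> verts H \<subseteq> verts G \<and> edges H \<subseteq> edges G"

definition isomorphic :: "'a hypergraph \<Rightarrow> 'b hypergraph \<Rightarrow> bool" where
  "isomorphic H K \<longleftrightarrow>
     (\<exists>f. bij_betw f (verts H) (verts K) \<and> (\<lambda>e. f ` e) ` edges H = edges K)"

definition family_free :: "nat \<Rightarrow> 'a hypergraph set \<Rightarrow> 'b hypergraph \<Rightarrow> bool" where
  "family_free r F G \<longleftrightarrow> \<not> (\<exists>H\<in>F. \<exists>K. subgraph r K G \<and> isomorphic H K)"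

definition deg :: "'a hypergraph \<Rightarrow> 'a set \<Rightarrow> nat" where
  "deg G S = card {e \<in> edges G. S \<subseteq> e}"

definition min_deg :: "nat \<Rightarrow> 'a hypergraph \<Rightarrow> nat" where
  "min_deg l G = Min (deg G ` nsets (verts G) l)"

text \<open>Host graphs have natural numbers as vertices; since vertex sets are finite, this covers
  every isomorphism type. For \<open>n < l\<close> the minimum degree, and hence \<open>turan_deg\<close>, is unspecified;
  only the behaviour for large \<open>n\<close> is used.\<close>

definition turan_deg :: "nat \<Rightarrow> nat \<Rightarrow> 'a hypergraph set \<Rightarrow> nat \<Rightarrow> nat" where
  "turan_deg r l F n =
     Max {min_deg l G | G :: nat hypergraph.
            rgraph r G \<and> card (verts G) = n \<and> family_free r F G}"

definition turan_density :: "nat \<Rightarrow> nat \<Rightarrow> 'a hypergraph set \<Rightarrow> real" where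
  "turan_density r l F =
     lim (\<lambda>n. real (turan_deg r l F n) / real ((n - l) choose (r - l)))"

text \<open>The largest \<open>d\<close> such that at most \<open>\<epsilon> * (v choose l)\<close> of the \<open>l\<close>-sets have degree less than
  \<open>d\<close>. In \<^typ>\<open>enat\<close> the supremum of a nonempty set is its maximum if the set is finite. It is
  \<open>\<infinity>\<close> when every \<open>d\<close> is admissible, i.e. when \<open>\<epsilon> \<ge> 1\<close> or \<open>v < l\<close>; in the sequences below this
  can happen only for finitely many indices.\<close>

definition eps_min_deg :: "nat \<Rightarrow> real \<Rightarrow> 'a hypergraph \<Rightarrow> enat" where
  "eps_min_deg l \<epsilon> G =
     Sup {enat d | d. real (card {S \<in> nsets (verts G) l. \<not> d \<le> deg G S})
                        \<le> \<epsilon> * real (card (verts G) choose l)}"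

definition has_seq_density :: "nat \<Rightarrow> nat \<Rightarrow> (nat \<Rightarrow> 'a hypergraph) \<Rightarrow> real \<Rightarrow> bool" where
  "has_seq_density r l G p \<longleftrightarrow>
     p \<in> {0..1} \<and>
     (\<exists>\<epsilon> :: nat \<Rightarrow> real. (\<forall>n. 0 \<le> \<epsilon> n) \<and> \<epsilon> \<longlonglongrightarrow> 0 \<and>
        (\<forall>n. ereal_of_enat (eps_min_deg l (\<epsilon> n) (G n))
               \<ge> ereal (p * real ((card (verts (G n)) - l) choose (r - l)))))"

definition rl_sequence :: "nat \<Rightarrow> nat \<Rightarrow> (nat \<Rightarrow> 'a hypergraph) \<Rightarrow> bool" where
  "rl_sequence r l G \<longleftrightarrow>
     (\<forall>n. rgraph r (G n)) \<and>
     filterlim (\<lambda>n. card (verts (G n))) at_top sequentially \<and>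
     (\<exists>p. has_seq_density r l G p)"

definition seq_density :: "nat \<Rightarrow> nat \<Rightarrow> (nat \<Rightarrow> 'a hypergraph) \<Rightarrow> real" where
  "seq_density r l G = Sup {p. has_seq_density r l G p}"

definition turan_density_star :: "nat \<Rightarrow> nat \<Rightarrow> 'a hypergraph set \<Rightarrow> real" where
  "turan_density_star r l F =
     Sup {seq_density r l G | G :: nat \<Rightarrow> nat hypergraph.
            rl_sequence r l G \<and> (\<forall>n. family_free r F (G n))}"

end

theory Submission
  imports Defs "HOL-Library.FuncSet"
begin

text \<open>
  Write \<open>T m\<close> for \<open>turan_deg r l F m\<close> divided by \<open>(m - l) choose (r - l)\<close>. The proof shows that
  \<open>T m\<close> converges to \<open>turan_density_star r l F\<close>; the existence of the limit defining
  \<open>turan_density r l F\<close> comes out of the same argument.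

  Infinitely many \<open>m\<close> with \<open>T m \<ge> q\<close> give an \<open>(r,l)\<close>-sequence of density at least \<open>q\<close>, made of
  extremal graphs (\<open>turan_density_star_ge_frequent\<close>). So \<open>T\<close> cannot stay infinitely often above the
  starred density by a fixed amount.

  Conversely, let \<open>G\<^sub>n\<close> be an \<open>F\<close>-free \<open>(r,l)\<close>-sequence of density \<open>p\<close>. A random set of \<open>m\<close> vertices of
  \<open>G\<^sub>n\<close>, with \<open>m\<close> large but fixed and \<open>n\<close> huge, induces an \<open>F\<close>-free graph in which with positive
  probability every \<open>l\<close>-set has degree at least \<open>p - e\<close> times the maximum possible, which gives
  \<open>T m \<ge> p - e\<close> (\<open>rel_turan_deg_ge_seq_density\<close>). The exceptional \<open>l\<close>-sets of low degree are so few
  that the sample avoids all of them; the difficulty is that all the polynomially many other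
  \<open>l\<close>-sets of the sample have to keep their relative degree simultaneously, for which
  Chebyshev's inequality is too weak in general; exponentially small failure probabilities
  suffice. These are obtained one vertex at a time: the relative degree of a set \<open>S\<close> is the average of the relative degrees of the sets
  \<open>insert v S\<close> (\<open>sum_rel_deg_insert\<close>), both in \<open>G\<^sub>n\<close> and in the sampled graph. If for all sets of
  sizes \<open>l, \<dots>, r - 1\<close> in the sample the average over the sample is close to the average over \<open>G\<^sub>n\<close>,
  then the relative degrees in the two graphs are close, by descending induction from
  \<open>r\<close>-sets (\<open>rel_deg_induced_ge\<close>). Each of these averages is a mean of independent bounded
  variables, and an elementary Chernoff bound (\<open>card_deviating_samples_le\<close>) with a union bound
  over all index sets finishes the proof.
\<close>

section \<open>Counting samples with replacement\<close>

lemma exp_le_quadratic: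
  fixes z :: real
  assumes "\<bar>z\<bar> \<le> 1"
  shows "exp z \<le> 1 + z + z\<^sup>2"
proof (cases "0 \<le> z")
  case True
  then show ?thesis using assms exp_bound by simp
next
  case False
  have "exp z = 1 / exp (- z)" by (simp add: exp_minus field_simps)
  also have "\<dots> \<le> 1 / (1 - z)"
    using False exp_ge_add_one_self[of "- z"] by (intro divide_left_mono) auto
  also have "\<dots> \<le> 1 + z + z\<^sup>2"
  proof -
    have "z * (z * z) \<le> 0"
      using False by (simp add: mult_nonneg_nonpos2 mult_nonpos_nonneg mult_nonneg_nonpos)
    then show ?thesis using False by (simp add: field_simps power2_eq_square)
  qed
  finally show ?thesis .
qed

text \<open>The one-point estimate behind the Chernoff bound below: the linear terms of the
  exponentials cancel because the deviations from the mean sum to \<open>0\<close>, so only the quadratic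
  terms survive.\<close>

lemma sum_exp_deviation_le:
  fixes g :: "'v \<Rightarrow> real" and t :: real
  assumes "finite V" "V \<noteq> {}" "\<And>v. 0 \<le> g v \<and> g v \<le> 1" "0 \<le> t" "t \<le> 1"
  shows "(\<Sum>v\<in>V. exp (t * ((\<Sum>w\<in>V. g w) / card V - g v))) \<le> card V * exp (t\<^sup>2)"
proof -
  define \<mu> where "\<mu> = (\<Sum>w\<in>V. g w) / card V"
  have V: "card V > 0" using assms by (simp add: card_gt_0_iff)
  have sum: "(\<Sum>w\<in>V. g w) = card V * \<mu>" using V by (simp add: \<mu>_def)
  have "0 \<le> \<mu>" unfolding \<mu>_def using assms by (intro divide_nonneg_nonneg sum_nonneg) auto
  moreover have "\<mu> \<le> 1"
    unfolding \<mu>_def using assms V sum_mono[of V g "\<lambda>_. 1"] by (simp add: divide_le_eq)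
  ultimately have dev: "\<bar>\<mu> - g v\<bar> \<le> 1" for v using assms(3)[of v] by linarith
  have "exp (t * (\<mu> - g v)) \<le> 1 + t * (\<mu> - g v) + t\<^sup>2" for v
  proof -
    have a: "\<bar>t * (\<mu> - g v)\<bar> \<le> t" using dev[of v] assms(4) by (simp add: abs_mult mult_left_le)
    then have "exp (t * (\<mu> - g v)) \<le> 1 + t * (\<mu> - g v) + (t * (\<mu> - g v))\<^sup>2"
      using assms(5) by (intro exp_le_quadratic) linarith
    moreover have "(t * (\<mu> - g v))\<^sup>2 \<le> t\<^sup>2" using a assms(4) abs_le_square_iff by fastforce
    ultimately show ?thesis by linarith
  qed
  then have "(\<Sum>v\<in>V. exp (t * (\<mu> - g v))) \<le> (\<Sum>v\<in>V. 1 + t * (\<mu> - g v) + t\<^sup>2)"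
    by (intro sum_mono)
  also have "\<dots> = card V * (1 + t\<^sup>2)"
    by (simp add: sum.distrib sum_subtractf sum_distrib_left[symmetric] sum algebra_simps)
  also have "\<dots> \<le> card V * exp (t\<^sup>2)" by (intro mult_left_mono) auto
  finally show ?thesis unfolding \<mu>_def .
qed

text \<open>The finite form of "condition on the coordinates in \<open>J\<close>, then use independence of
  those in \<open>R\<close>": a sum over all maps \<open>J \<union> R \<rightarrow> V\<close> of a product over \<open>R\<close> can be carried out one
  coordinate of \<open>R\<close> at a time, since each factor sees, besides its own coordinate, only the
  image of \<open>J\<close>.\<close>

lemma sum_prod_PiE_le:
  fixes \<phi> :: "'v set \<Rightarrow> 'v \<Rightarrow> real" and c :: real
  assumes "finite R" "finite J" "J \<inter> R = {}" "finite V"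
    and nonneg: "\<And>S v. 0 \<le> \<phi> S v" and c: "\<And>S. (\<Sum>v\<in>V. \<phi> S v) \<le> c"
  shows "(\<Sum>x\<in>J \<union> R \<rightarrow>\<^sub>E V. \<Prod>i\<in>R. \<phi> (x ` J) (x i)) \<le> c ^ card R * real (card V) ^ card J"
  using assms(1,3)
proof (induction R)
  case empty
  then show ?case using assms by (simp add: card_PiE)
next
  case (insert a R)
  have a: "a \<notin> J \<union> R" using insert by auto
  have c0: "0 \<le> c" using c[of "{}"] nonneg by (meson order_trans sum_nonneg)
  have upd: "(g(a := y)) ` J = g ` J" for g :: "'a \<Rightarrow> 'v" and y using a by auto
  have "(\<Sum>x\<in>J \<union> insert a R \<rightarrow>\<^sub>E V. \<Prod>i\<in>insert a R. \<phi> (x ` J) (x i))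
      = (\<Sum>(y, g)\<in>V \<times> (J \<union> R \<rightarrow>\<^sub>E V). \<Prod>i\<in>insert a R. \<phi> (g ` J) ((g(a := y)) i))"
    using inj_combinator[OF a, of "\<lambda>_. V"]
    by (simp add: PiE_insert_eq sum.reindex case_prod_unfold upd del: fun_upd_image fun_upd_apply)
  also have "\<dots> = (\<Sum>y\<in>V. \<Sum>g\<in>J \<union> R \<rightarrow>\<^sub>E V. \<phi> (g ` J) y * (\<Prod>i\<in>R. \<phi> (g ` J) (g i)))"
    unfolding sum.cartesian_product[symmetric]
  proof (intro sum.cong refl)
    fix y g
    have "(\<Prod>i\<in>R. \<phi> (g ` J) ((g(a := y)) i)) = (\<Prod>i\<in>R. \<phi> (g ` J) (g i))"
      using a by (intro prod.cong) auto
    then show "(\<Prod>i\<in>insert a R. \<phi> (g ` J) ((g(a := y)) i))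
        = \<phi> (g ` J) y * (\<Prod>i\<in>R. \<phi> (g ` J) (g i))"
      using insert by simp
  qed
  also have "\<dots> = (\<Sum>g\<in>J \<union> R \<rightarrow>\<^sub>E V. (\<Sum>y\<in>V. \<phi> (g ` J) y) * (\<Prod>i\<in>R. \<phi> (g ` J) (g i)))"
    by (subst sum.swap) (simp add: sum_distrib_right)
  also have "\<dots> \<le> (\<Sum>g\<in>J \<union> R \<rightarrow>\<^sub>E V. c * (\<Prod>i\<in>R. \<phi> (g ` J) (g i)))"
    using c nonneg by (intro sum_mono mult_right_mono prod_nonneg) auto
  also have "\<dots> = c * (\<Sum>g\<in>J \<union> R \<rightarrow>\<^sub>E V. \<Prod>i\<in>R. \<phi> (g ` J) (g i))"
    by (simp add: sum_distrib_left)
  also have "\<dots> \<le> c * (c ^ card R * real (card V) ^ card J)"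
    using insert c0 by (intro mult_left_mono) auto
  finally show ?case using insert by simp
qed

text \<open>A one-sided Chernoff bound, with the number of samples in place of probability. A map
  \<open>x : A \<rightarrow> V\<close> is a sample of independent uniform points; the function \<open>g S\<close> whose empirical mean
  over \<open>A - J\<close> is compared with its true mean may depend on the set \<open>S = x ` J\<close> of the points
  outside \<open>A - J\<close>. The exponential moment with parameter \<open>t = \<eta> / 2\<close> gives the exponent
  \<open>t\<^sup>2 - t \<eta> = - \<eta>\<^sup>2 / 4\<close> per coordinate, by Markov's inequality.\<close>

lemma card_deviating_samples_le:
  fixes g :: "'v set \<Rightarrow> 'v \<Rightarrow> real" and \<eta> :: real
  assumes "finite A" "J \<subseteq> A" "finite V" "V \<noteq> {}" "\<And>S v. 0 \<le> g S v \<and> g S v \<le> 1"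
    and "0 < \<eta>" "\<eta> \<le> 1"
  shows "real (card {x \<in> A \<rightarrow>\<^sub>E V. (\<Sum>i\<in>A - J. g (x ` J) (x i))
            < card (A - J) * ((\<Sum>v\<in>V. g (x ` J) v) / card V - \<eta>)})
          \<le> exp (- (\<eta>\<^sup>2 / 4) * card (A - J)) * real (card V) ^ card A"
    (is "real (card ?B) \<le> _")
proof -
  define t where "t = \<eta> / 2"
  define d where "d = card (A - J)"
  define n where "n = card V"
  define \<mu> where "\<mu> S = (\<Sum>v\<in>V. g S v) / n" for S
  define \<phi> where "\<phi> S v = exp (t * (\<mu> S - g S v))" for S v
  have fin: "finite (A - J)" "finite J" "finite (A \<rightarrow>\<^sub>E V)"
    using assms finite_subset[OF assms(2,1)] by (auto intro: finite_PiE)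
  have A: "J \<union> (A - J) = A" "card A = d + card J"
    using assms by (auto simp: d_def card_Diff_subset finite_subset card_mono)
  have \<phi>: "(\<Sum>v\<in>V. \<phi> S v) \<le> n * exp (t\<^sup>2)" for S
    unfolding \<phi>_def \<mu>_def n_def using assms by (intro sum_exp_deviation_le) (auto simp: t_def)
  \<comment> \<open>Markov's inequality: every deviating sample contributes at least \<open>exp (t \<eta> d)\<close>.\<close>
  have "card ?B * exp (t * \<eta> * d) = (\<Sum>x\<in>?B. exp (t * \<eta> * d))" by simp
  also have "\<dots> \<le> (\<Sum>x\<in>?B. \<Prod>i\<in>A - J. \<phi> (x ` J) (x i))"
  proof (intro sum_mono)
    fix x assume "x \<in> ?B"
    then have "\<eta> * d \<le> (\<Sum>i\<in>A - J. \<mu> (x ` J) - g (x ` J) (x i))"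
      by (simp add: sum_subtractf d_def \<mu>_def n_def algebra_simps)
    then have "t * (\<eta> * d) \<le> t * (\<Sum>i\<in>A - J. \<mu> (x ` J) - g (x ` J) (x i))"
      using assms by (intro mult_left_mono) (auto simp: t_def)
    then show "exp (t * \<eta> * d) \<le> (\<Prod>i\<in>A - J. \<phi> (x ` J) (x i))"
      using fin by (simp add: \<phi>_def exp_sum[symmetric] sum_distrib_left[symmetric] mult.assoc)
  qed
  also have "\<dots> \<le> (\<Sum>x\<in>A \<rightarrow>\<^sub>E V. \<Prod>i\<in>A - J. \<phi> (x ` J) (x i))"
    using fin by (intro sum_mono2) (auto simp: \<phi>_def intro!: prod_nonneg)
  also have "\<dots> \<le> (n * exp (t\<^sup>2)) ^ d * real n ^ card J"
  proof -
    have "(\<Sum>x\<in>J \<union> (A - J) \<rightarrow>\<^sub>E V. \<Prod>i\<in>A - J. \<phi> (x ` J) (x i)) \<le> (n * exp (t\<^sup>2)) ^ d * real n ^ card J"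
      unfolding d_def n_def using fin assms(3) \<phi>
      by (intro sum_prod_PiE_le) (auto simp: \<phi>_def n_def)
    then show ?thesis by (simp only: A(1))
  qed
  also have "\<dots> = exp (t\<^sup>2 * d) * real n ^ card A"
    by (simp add: A(2) power_add power_mult_distrib exp_of_nat_mult[symmetric] mult_ac)
  finally have "card ?B * exp (t * \<eta> * d) \<le> exp (t\<^sup>2 * d) * real n ^ card A" .
  then have "card ?B \<le> exp (t\<^sup>2 * d) * real n ^ card A / exp (t * \<eta> * d)"
    by (simp add: le_divide_eq)
  also have "\<dots> = exp (t\<^sup>2 * d - t * \<eta> * d) * real n ^ card A" by (simp add: exp_diff)
  also have "t\<^sup>2 * d - t * \<eta> * d = - (\<eta>\<^sup>2 / 4) * d"
    by (simp add: t_def power2_eq_square field_simps)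
  finally show ?thesis by (simp add: d_def n_def)
qed

text \<open>Used both for collisions (\<open>I\<close> a pair and \<open>B\<close> the singletons) and for the event that \<open>I\<close>
  lands on a vertex set of low degree. If \<open>x ` I = S\<close>, then the coordinates in \<open>I\<close> take values
  in \<open>S\<close> and the others are free.\<close>

lemma card_samples_image_in_le:
  assumes "finite A" "I \<subseteq> A" "finite V" "finite B" "\<And>S. S \<in> B \<Longrightarrow> finite S \<and> card S \<le> s"
  shows "card {x \<in> A \<rightarrow>\<^sub>E V. x ` I \<in> B} \<le> card B * s ^ card I * card V ^ card (A - I)"
proof -
  let ?P = "\<lambda>S. PiE A (\<lambda>i. if i \<in> I then S else V)"
  have fin: "finite (?P S)" if "S \<in> B" for S
    using that assms by (intro finite_PiE) auto
  have "{x \<in> A \<rightarrow>\<^sub>E V. x ` I \<in> B} \<subseteq> (\<Union>S\<in>B. ?P S)"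
  proof
    fix x assume x: "x \<in> {x \<in> A \<rightarrow>\<^sub>E V. x ` I \<in> B}"
    then have "x \<in> ?P (x ` I)" by (auto simp: PiE_iff)
    then show "x \<in> (\<Union>S\<in>B. ?P S)" using x by blast
  qed
  then have "card {x \<in> A \<rightarrow>\<^sub>E V. x ` I \<in> B} \<le> card (\<Union>S\<in>B. ?P S)"
    using assms fin by (intro card_mono) auto
  also have "\<dots> \<le> (\<Sum>S\<in>B. card (?P S))" using assms by (intro card_UN_le) auto
  also have "\<dots> \<le> (\<Sum>S\<in>B. s ^ card I * card V ^ card (A - I))"
  proof (intro sum_mono)
    fix S assume S: "S \<in> B"
    have "card (?P S) = (\<Prod>i\<in>A. if i \<in> I then card S else card V)"
      using assms by (simp add: card_PiE if_distrib cong: if_cong)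
    also have "\<dots> = card S ^ card I * card V ^ card (A - I)"
      using assms by (simp add: prod.If_cases Int_absorb1 Diff_eq)
    also have "\<dots> \<le> s ^ card I * card V ^ card (A - I)"
      using assms S by (intro mult_right_mono power_mono) auto
    finally show "card (?P S) \<le> s ^ card I * card V ^ card (A - I)" .
  qed
  finally show ?thesis by simp
qed

lemma power_times_exp_decay_tendsto_0:
  fixes c :: real assumes "0 < c"
  shows "(\<lambda>m. real m ^ j * exp (- c * (real m - real j))) \<longlonglongrightarrow> 0"
proof -
  have "filterlim (\<lambda>m. c * real m) at_top sequentially"
    using assms filterlim_real_sequentially
    by (intro filterlim_tendsto_pos_mult_at_top[OF tendsto_const])
  then have "(\<lambda>m. (c * real m) ^ j / exp (c * real m)) \<longlonglongrightarrow> 0"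
    by (rule filterlim_compose[OF tendsto_power_div_exp_0])
  then have "(\<lambda>m. exp (c * real j) / c ^ j * ((c * real m) ^ j / exp (c * real m))) \<longlonglongrightarrow> 0"
    by (rule tendsto_mult_right_zero)
  moreover have "exp (c * real j) / c ^ j * ((c * real m) ^ j / exp (c * real m))
      = real m ^ j * exp (- c * (real m - real j))" for m
  proof -
    have "- c * (real m - real j) = c * real j - c * real m" by (simp add: algebra_simps)
    then have "exp (- c * (real m - real j)) = exp (c * real j) / exp (c * real m)"
      by (simp only: exp_diff)
    then show ?thesis using assms by (simp add: power_mult_distrib)
  qed
  ultimately show ?thesis by simp
qed

section \<open>Relative degrees and induced subgraphs\<close>

text \<open>The degree of \<open>S\<close> as a fraction of the number of \<open>r\<close>-sets containing \<open>S\<close>. With this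
  normalisation the averaging identity below has no binomial coefficients, and the value on an
  \<open>r\<close>-set is \<open>1\<close> or \<open>0\<close> according to whether it is an edge.\<close>

definition rel_deg :: "nat \<Rightarrow> 'a hypergraph \<Rightarrow> 'a set \<Rightarrow> real" where
  "rel_deg r G S = deg G S / ((card (verts G) - card S) choose (r - card S))"

definition induced_subgraph :: "'a hypergraph \<Rightarrow> 'a set \<Rightarrow> 'a hypergraph" where
  "induced_subgraph G M = \<lparr>verts = M, edges = {e \<in> edges G. e \<subseteq> M}\<rparr>"

lemma induced_subgraph_simps [simp]:
  "verts (induced_subgraph G M) = M" "edges (induced_subgraph G M) = {e \<in> edges G. e \<subseteq> M}"
  by (simp_all add: induced_subgraph_def)

lemma rgraph_edge: "rgraph r G \<Longrightarrow> e \<in> edges G \<Longrightarrow> e \<subseteq> verts G \<and> finite e \<and> card e = r"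
  by (auto simp: rgraph_def nsets_def)

lemma finite_edges: "rgraph r G \<Longrightarrow> finite (edges G)"
  by (meson finite_imp_finite_nsets finite_subset rgraph_def)

lemma rgraph_induced: "rgraph r G \<Longrightarrow> M \<subseteq> verts G \<Longrightarrow> rgraph r (induced_subgraph G M)"
  by (auto simp: rgraph_def nsets_def intro: finite_subset)

lemma family_free_induced:
  "family_free r F G \<Longrightarrow> M \<subseteq> verts G \<Longrightarrow> family_free r F (induced_subgraph G M)"
  unfolding family_free_def subgraph_def induced_subgraph_simps by blast

text \<open>Sets \<open>S\<close> with too many elements, or not contained in the vertex set, lie in no edge, so the
  bound holds for every \<open>S\<close>; hence \<open>rel_deg\<close> always lies between \<open>0\<close> and \<open>1\<close>, as the Chernoff
  bound requires.\<close>

lemma deg_le_choose: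
  assumes "rgraph r G"
  shows "deg G S \<le> (card (verts G) - card S) choose (r - card S)"
proof (cases "S \<subseteq> verts G")
  case True
  let ?E = "{e \<in> edges G. S \<subseteq> e}"
  have V: "finite (verts G)" using assms by (simp add: rgraph_def)
  have S: "finite S" using True V finite_subset by blast
  have "inj_on (\<lambda>e. e - S) ?E" by (auto simp: inj_on_def)
  moreover have "(\<lambda>e. e - S) ` ?E \<subseteq> nsets (verts G - S) (r - card S)"
  proof
    fix x assume "x \<in> (\<lambda>e. e - S) ` ?E"
    then obtain e where "e \<in> edges G" "S \<subseteq> e" "x = e - S" by auto
    then show "x \<in> nsets (verts G - S) (r - card S)"
      using rgraph_edge[OF assms, of e] S by (auto simp: nsets_def card_Diff_subset)
  qed
  ultimately have "card ?E \<le> card (nsets (verts G - S) (r - card S))"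
    using V by (intro card_inj_on_le) (auto intro: finite_imp_finite_nsets)
  then show ?thesis using V S True by (simp add: deg_def card_nsets card_Diff_subset)
next
  case False
  then have "{e \<in> edges G. S \<subseteq> e} = {}" using rgraph_edge[OF assms] by blast
  then show ?thesis unfolding deg_def by (metis card.empty zero_le)
qed

lemma rel_deg_bounds:
  assumes "rgraph r G"
  shows "0 \<le> rel_deg r G S" "rel_deg r G S \<le> 1"
  using deg_le_choose[OF assms, of S] by (auto simp: rel_deg_def divide_le_eq)

text \<open>Double counting of the pairs \<open>(v, e)\<close> with \<open>S \<subseteq> e\<close> and \<open>v \<in> e - S\<close>.\<close>

lemma sum_deg_insert:
  assumes "rgraph r G" "S \<subseteq> verts G"
  shows "(\<Sum>v\<in>verts G - S. deg G (insert v S)) = (r - card S) * deg G S"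
proof -
  let ?E = "{e \<in> edges G. S \<subseteq> e}"
  have fin: "finite (verts G)" "finite S" "finite ?E"
    using assms finite_subset finite_edges[OF assms(1)] by (auto simp: rgraph_def)
  have "(\<Sum>v\<in>verts G - S. deg G (insert v S)) = (\<Sum>v\<in>verts G - S. \<Sum>e\<in>?E. of_bool (v \<in> e))"
  proof (intro sum.cong refl)
    fix v
    have "{e \<in> edges G. insert v S \<subseteq> e} = {e \<in> ?E. v \<in> e}" by auto
    then show "deg G (insert v S) = (\<Sum>e\<in>?E. of_bool (v \<in> e))"
      using fin by (simp add: deg_def sum_of_bool_eq Int_def)
  qed
  also have "\<dots> = (\<Sum>e\<in>?E. \<Sum>v\<in>verts G - S. of_bool (v \<in> e))" by (rule sum.swap)
  also have "\<dots> = (\<Sum>e\<in>?E. r - card S)"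
  proof (intro sum.cong refl)
    fix e assume e: "e \<in> ?E"
    then have "(verts G - S) \<inter> {v. v \<in> e} = e - S" using rgraph_edge[OF assms(1)] by blast
    then show "(\<Sum>v\<in>verts G - S. of_bool (v \<in> e)) = r - card S"
      using fin e rgraph_edge[OF assms(1), of e]
      by (simp add: sum_of_bool_eq card_Diff_subset)
  qed
  finally show ?thesis by (simp add: deg_def)
qed

text \<open>The identity that lets concentration be proved one vertex at a time: relative degrees
  average over one-vertex extensions without any error term, in \<open>G\<close> as well as in its induced
  subgraphs on at least \<open>r\<close> vertices. The binomial coefficients cancel by absorption.\<close>

lemma sum_rel_deg_insert:
  assumes "rgraph r G" "S \<subseteq> verts G" "card S < r" "r \<le> card (verts G)"
  shows "(\<Sum>v\<in>verts G - S. rel_deg r G (insert v S)) = real (card (verts G) - card S) * rel_deg r G S"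
proof -
  define a where "a = card (verts G) - Suc (card S)"
  define b where "b = r - Suc (card S)"
  have S: "finite S" using assms finite_subset by (auto simp: rgraph_def)
  have ab: "card (verts G) - card S = Suc a" "r - card S = Suc b" "b \<le> a"
    using assms by (auto simp: a_def b_def)
  have "(\<Sum>v\<in>verts G - S. rel_deg r G (insert v S))
      = (\<Sum>v\<in>verts G - S. deg G (insert v S) / real (a choose b))"
    using S by (intro sum.cong) (auto simp: rel_deg_def a_def b_def)
  also have "\<dots> = real (Suc b * deg G S) / real (a choose b)"
    using sum_deg_insert[OF assms(1,2)]
    by (simp add: sum_divide_distrib[symmetric] of_nat_sum[symmetric] ab(2) del: of_nat_sum)
  also have "\<dots> = real (Suc a) * (deg G S / real (Suc a choose Suc b))"
  proof -
    have key: "y * D / Y = x * (D / X)" if "y * X = x * Y" "Y > 0" "X > 0" for x y X Y D :: real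
      using that by (simp add: divide_simps)
    have "real (Suc b) * real (Suc a choose Suc b) = real (Suc a) * real (a choose b)"
      using Suc_times_binomial[of b a] by (simp only: of_nat_mult[symmetric])
    moreover have "real (a choose b) > 0" "real (Suc a choose Suc b) > 0"
      using ab(3) by (simp_all del: binomial_Suc_Suc)
    ultimately show ?thesis unfolding of_nat_mult by (rule key)
  qed
  finally show ?thesis by (simp add: rel_deg_def ab)
qed

text \<open>If averaging over one-vertex extensions inside \<open>M\<close> loses at most \<open>\<eta>\<close> compared with
  averaging in \<open>G\<close>, for sets of every size from \<open>l\<close> to \<open>r - 1\<close>, then passing to the induced
  subgraph costs an \<open>l\<close>-set at most \<open>(r - l) \<eta>\<close> of its relative degree. The induction descends
  from \<open>r\<close>-sets, whose relative degree is the same in both graphs. This replaces a concentration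
  inequality for degrees, which count \<open>(r - l)\<close>-sets, by one for averages over single
  vertices.\<close>

lemma rel_deg_induced_ge:
  fixes \<eta> :: real
  assumes G: "rgraph r G" and M: "M \<subseteq> verts G" "r \<le> card M"
    and avg: "\<And>S. S \<subseteq> M \<Longrightarrow> l \<le> card S \<Longrightarrow> card S < r \<Longrightarrow>
       real (card M - card S) * (rel_deg r G S - \<eta>) \<le> (\<Sum>v\<in>M - S. rel_deg r G (insert v S))"
    and S: "S \<subseteq> M" "l \<le> card S" "card S \<le> r"
  shows "rel_deg r G S - real (r - card S) * \<eta> \<le> rel_deg r (induced_subgraph G M) S"
  using S
proof (induction "r - card S" arbitrary: S)
  case 0
  then have r: "card S = r" by simp
  have "e = S" if "e \<in> edges G" "S \<subseteq> e" for e
    using that r rgraph_edge[OF G, of e] by (metis card_subset_eq)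
  then have "{e \<in> edges G. S \<subseteq> e} = {e \<in> edges (induced_subgraph G M). S \<subseteq> e}"
    using "0.prems" by auto
  then have "deg G S = deg (induced_subgraph G M) S" by (simp add: deg_def)
  then show ?case using r by (simp add: rel_deg_def)
next
  case (Suc k)
  have "finite M" using G M finite_subset by (auto simp: rgraph_def)
  then have fin: "finite M" "finite S" "card (M - S) = card M - card S"
    using Suc.prems finite_subset[OF Suc.prems(1)] by (auto simp: card_Diff_subset)
  define d where "d = card M - card S"
  have lt: "card S < r" using Suc by linarith
  have d: "0 < d" using lt M by (simp add: d_def)
  have "d * (rel_deg r G S - \<eta>) - d * (real k * \<eta>) \<le> (\<Sum>v\<in>M - S. rel_deg r G (insert v S)) - d * (real k * \<eta>)"
    using avg[OF Suc.prems(1,2) lt] by (simp add: d_def)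
  also have "\<dots> = (\<Sum>v\<in>M - S. rel_deg r G (insert v S) - real k * \<eta>)"
    by (simp add: sum_subtractf fin d_def)
  also have "\<dots> \<le> (\<Sum>v\<in>M - S. rel_deg r (induced_subgraph G M) (insert v S))"
  proof (intro sum_mono)
    fix v assume v: "v \<in> M - S"
    then have c: "card (insert v S) = Suc (card S)" using fin by simp
    then have k: "k = r - card (insert v S)" using Suc by simp
    show "rel_deg r G (insert v S) - real k * \<eta> \<le> rel_deg r (induced_subgraph G M) (insert v S)"
      using Suc.hyps(1)[OF k] v c Suc.prems lt k by simp
  qed
  also have "\<dots> = d * rel_deg r (induced_subgraph G M) S"
    using sum_rel_deg_insert[OF rgraph_induced[OF G M(1)]] Suc.prems lt M by (simp add: d_def)
  finally have "d * (rel_deg r G S - real (Suc k) * \<eta>) \<le> d * rel_deg r (induced_subgraph G M) S"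
    by (simp add: algebra_simps)
  then show ?case using d Suc.hyps(2) by (simp del: of_nat_Suc)
qed

section \<open>Induced subgraphs on random vertex sets\<close>

lemma card_UN_nsets_le:
  fixes b :: real
  assumes "finite A" "0 \<le> b" "\<And>I. I \<in> nsets A k \<Longrightarrow> real (card (C I)) \<le> b"
  shows "real (card (\<Union>I\<in>nsets A k. C I)) \<le> real (card A) ^ k * b"
proof -
  have "card (\<Union>I\<in>nsets A k. C I) \<le> (\<Sum>I\<in>nsets A k. card (C I))"
    using assms by (intro card_UN_le finite_imp_finite_nsets)
  then have "real (card (\<Union>I\<in>nsets A k. C I)) \<le> (\<Sum>I\<in>nsets A k. real (card (C I)))"
    by (metis of_nat_mono of_nat_sum)
  also have "\<dots> \<le> real (card A choose k) * b"
    using sum_mono[of "nsets A k" "\<lambda>I. real (card (C I))" "\<lambda>_. b"] assms by (simp add: card_nsets)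
  also have "card A choose k \<le> card A ^ k"
    by (cases "k \<le> card A") (auto intro: binomial_le_pow simp: binomial_eq_0)
  then have "real (card A choose k) * b \<le> real (card A) ^ k * b"
    using assms(2) by (intro mult_right_mono) (auto simp flip: of_nat_power)
  finally show ?thesis .
qed

text \<open>A random sample \<open>x\<close> of \<open>m\<close> vertices of \<open>G\<close>, drawn with replacement, spans a suitable
  subgraph unless it has a repetition, or hits a set of low degree, or has an index set \<open>J\<close> whose
  image \<open>S\<close> has, over the remaining sample points, an average extension degree more than \<open>\<eta>\<close>
  below the true one. The three summands in the hypothesis \<open>small\<close> bound the proportions of these
  samples. The first two vanish when \<open>n \<rightarrow> \<infinity>\<close> and \<open>\<epsilon> \<rightarrow> 0\<close> with \<open>m\<close> fixed, and the third when
  \<open>m \<rightarrow> \<infinity>\<close>.\<close>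

lemma exists_induced_subgraph_min_rel_deg:
  fixes \<eta> \<epsilon> p :: real
  assumes G: "rgraph r G" and V: "card (verts G) = n" "0 < n"
    and \<eta>: "0 < \<eta>" "\<eta> \<le> 1" and m: "l \<le> r" "r \<le> m" and \<epsilon>: "0 \<le> \<epsilon>"
    and low: "card {S \<in> nsets (verts G) l. rel_deg r G S < p} \<le> \<epsilon> * (n choose l)"
    and small: "real m ^ 2 / n + real m ^ l * (real l ^ l * \<epsilon>)
       + (\<Sum>j\<in>{l..<r}. real m ^ j * exp (- (\<eta>\<^sup>2 / 4) * (real m - j))) < 1"
  shows "\<exists>M\<subseteq>verts G. card M = m \<and>
    (\<forall>S\<in>nsets M l. p - real (r - l) * \<eta> \<le> rel_deg r (induced_subgraph G M) S)"
proof -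
  define V where "V = verts G"
  define A where "A = {..<m}"
  define X where "X = A \<rightarrow>\<^sub>E V"
  define B where "B = {S \<in> nsets V l. rel_deg r G S < p}"
  \<comment> \<open>On \<open>S\<close> itself \<open>g S\<close> takes the value that makes its mean over all of \<open>V\<close> equal to \<open>rel_deg r G S\<close>.\<close>
  define g where "g S v = (if v \<in> S then rel_deg r G S else rel_deg r G (insert v S))" for S v
  define coll where "coll = (\<Union>I\<in>nsets A 2. {x \<in> X. x ` I \<in> (\<lambda>v. {v}) ` V})"
  define hit where "hit = (\<Union>I\<in>nsets A l. {x \<in> X. x ` I \<in> B})"
  define dev where "dev J = {x \<in> A \<rightarrow>\<^sub>E V. (\<Sum>i\<in>A - J. g (x ` J) (x i))
            < card (A - J) * ((\<Sum>v\<in>V. g (x ` J) v) / card V - \<eta>)}" for J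
  define devs where "devs j = (\<Union>J\<in>nsets A j. dev J)" for j
  have A: "finite A" "card A = m" by (simp_all add: A_def)
  have Vn: "finite V" "card V = n" "V \<noteq> {}" using G V by (auto simp: V_def rgraph_def)
  have X: "finite X" "card X = n ^ m"
    using A Vn by (auto simp: X_def card_PiE intro: finite_PiE)
  have finB: "finite B" using Vn by (simp add: B_def finite_imp_finite_nsets)
  have n_pow: "real n ^ k * real n ^ (m - k) = real n ^ m" if "k \<le> m" for k
    using that by (simp flip: power_add)
  have "real (card coll) \<le> real m ^ 2 * (real n ^ m / n)"
    unfolding coll_def A(2)[symmetric]
  proof (intro card_UN_nsets_le A(1))
    fix I assume "I \<in> nsets A 2"
    then have I: "I \<subseteq> A" "finite I" "card I = 2" by (auto simp: nsets_def)
    then have m2: "2 \<le> m" using A card_mono by metis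
    have "card {x \<in> X. x ` I \<in> (\<lambda>v. {v}) ` V}
        \<le> card ((\<lambda>v. {v}) ` V) * 1 ^ card I * card V ^ card (A - I)"
      unfolding X_def using A Vn I by (intro card_samples_image_in_le) auto
    also have "\<dots> = n * n ^ (m - 2)"
      using I A Vn by (simp add: card_image card_Diff_subset)
    finally have "real (card {x \<in> X. x ` I \<in> (\<lambda>v. {v}) ` V}) \<le> real (n * n ^ (m - 2))"
      by (rule of_nat_mono)
    also have "\<dots> = real n ^ m / n"
      using n_pow[OF m2] V(2) by (simp add: field_simps power2_eq_square)
    finally show "real (card {x \<in> X. x ` I \<in> (\<lambda>v. {v}) ` V}) \<le> real n ^ card A / n"
      by (simp add: A)
  qed auto
  moreover have "real (card hit) \<le> real m ^ l * (real l ^ l * \<epsilon> * real n ^ m)"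
    unfolding hit_def A(2)[symmetric]
  proof (intro card_UN_nsets_le A(1))
    fix I assume "I \<in> nsets A l"
    then have I: "I \<subseteq> A" "finite I" "card I = l" by (auto simp: nsets_def)
    have "card {x \<in> X. x ` I \<in> B} \<le> card B * l ^ card I * card V ^ card (A - I)"
      unfolding X_def using A Vn I finB by (intro card_samples_image_in_le) (auto simp: B_def nsets_def)
    also have "\<dots> = card B * l ^ l * n ^ (m - l)"
      using I A Vn by (simp add: card_Diff_subset)
    finally have "real (card {x \<in> X. x ` I \<in> B}) \<le> real (card B * l ^ l * n ^ (m - l))"
      by (rule of_nat_mono)
    also have "\<dots> = real (card B) * (real l ^ l * real n ^ (m - l))" by simp
    also have "\<dots> \<le> (\<epsilon> * real n ^ l) * (real l ^ l * real n ^ (m - l))"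
    proof (intro mult_right_mono)
      have "n choose l \<le> n ^ l"
        by (cases "l \<le> n") (auto intro: binomial_le_pow simp: binomial_eq_0)
      then have "real (n choose l) \<le> real n ^ l" by (simp flip: of_nat_power)
      then show "real (card B) \<le> \<epsilon> * real n ^ l"
        using low \<epsilon> mult_left_mono[of "real (n choose l)" "real n ^ l" \<epsilon>] by (simp add: B_def V_def)
    qed auto
    also have "\<dots> = real l ^ l * \<epsilon> * real n ^ card A" using n_pow[of l] m A by (simp add: mult_ac)
    finally show "real (card {x \<in> X. x ` I \<in> B}) \<le> real l ^ l * \<epsilon> * real n ^ card A" .
  qed (use \<epsilon> in auto)
  moreover have "real (card (devs j)) \<le> real m ^ j * (exp (- (\<eta>\<^sup>2 / 4) * (real m - j)) * real n ^ m)"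
    if j: "j \<in> {l..<r}" for j
    unfolding devs_def A(2)[symmetric]
  proof (intro card_UN_nsets_le A(1))
    fix J assume "J \<in> nsets A j"
    then have J: "J \<subseteq> A" "finite J" "card J = j" by (auto simp: nsets_def)
    have "real (card (dev J)) \<le> exp (- (\<eta>\<^sup>2 / 4) * card (A - J)) * real (card V) ^ card A"
      unfolding dev_def using A J Vn \<eta> rel_deg_bounds[OF G]
      by (intro card_deviating_samples_le) (auto simp: g_def)
    moreover have "real (card (A - J)) = real (card A) - j"
      using A J j m by (simp add: card_Diff_subset of_nat_diff)
    ultimately show "real (card (dev J)) \<le> exp (- (\<eta>\<^sup>2 / 4) * (real (card A) - j)) * real n ^ card A"
      by (simp add: Vn)
  qed auto
  then have "(\<Sum>j\<in>{l..<r}. real (card (devs j)))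
      \<le> (\<Sum>j\<in>{l..<r}. real m ^ j * exp (- (\<eta>\<^sup>2 / 4) * (real m - j))) * real n ^ m"
    by (simp only: sum_distrib_right mult.assoc[symmetric]) (intro sum_mono, simp)
  moreover have "card (coll \<union> hit \<union> (\<Union>j\<in>{l..<r}. devs j)) \<le> card coll + card hit + (\<Sum>j\<in>{l..<r}. card (devs j))"
    by (intro order_trans[OF card_Un_le] add_mono card_Un_le card_UN_le) auto
  then have "real (card (coll \<union> hit \<union> (\<Union>j\<in>{l..<r}. devs j)))
      \<le> real (card coll) + real (card hit) + (\<Sum>j\<in>{l..<r}. real (card (devs j)))"
    by (simp only: of_nat_add[symmetric] of_nat_sum[symmetric] of_nat_le_iff)
  ultimately have "real (card (coll \<union> hit \<union> (\<Union>j\<in>{l..<r}. devs j)))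
      \<le> (real m ^ 2 / n + real m ^ l * (real l ^ l * \<epsilon>)
       + (\<Sum>j\<in>{l..<r}. real m ^ j * exp (- (\<eta>\<^sup>2 / 4) * (real m - j)))) * real n ^ m"
    by (simp add: algebra_simps)
  also have "\<dots> < 1 * real n ^ m"
    using small V(2) by (intro mult_strict_right_mono) auto
  finally have "real (card (coll \<union> hit \<union> (\<Union>j\<in>{l..<r}. devs j))) < real (card X)"
    by (simp add: X)
  moreover have "coll \<union> hit \<union> (\<Union>j\<in>{l..<r}. devs j) \<subseteq> X"
    by (auto simp: coll_def hit_def devs_def dev_def X_def)
  ultimately have "\<not> X \<subseteq> coll \<union> hit \<union> (\<Union>j\<in>{l..<r}. devs j)"
    by (metis order_less_irrefl subset_antisym)
  then obtain x where x: "x \<in> X" "x \<notin> coll" "x \<notin> hit" "\<And>j. j \<in> {l..<r} \<Longrightarrow> x \<notin> devs j"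
    by blast
  have xV: "x i \<in> V" if "i \<in> A" for i using x(1) that by (auto simp: X_def)
  have inj: "inj_on x A"
  proof (rule inj_onI, rule ccontr)
    fix i j assume ij: "i \<in> A" "j \<in> A" "x i = x j" "i \<noteq> j"
    then have "{i, j} \<in> nsets A 2" by (simp add: nsets_def)
    moreover have "x ` {i, j} \<in> (\<lambda>v. {v}) ` V" using ij xV by auto
    ultimately show False using x(1,2) unfolding coll_def by blast
  qed
  define M where "M = x ` A"
  have M: "M \<subseteq> V" "card M = m" "finite M"
    using xV inj A by (auto simp: M_def card_image)
  have index: "\<exists>J. J \<in> nsets A (card S) \<and> x ` J = S" if "S \<subseteq> M" for S
  proof (intro exI conjI)
    let ?J = "{i \<in> A. x i \<in> S}"
    show "x ` ?J = S" using that by (auto simp: M_def)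
    moreover have "inj_on x ?J" using inj by (rule inj_on_subset) auto
    ultimately have "card ?J = card S" using card_image by metis
    then show "?J \<in> nsets A (card S)" using A by (simp add: nsets_def)
  qed
  have avg: "real (card M - card S) * (rel_deg r G S - \<eta>) \<le> (\<Sum>v\<in>M - S. rel_deg r G (insert v S))"
    if S: "S \<subseteq> M" "l \<le> card S" "card S < r" for S
  proof -
    obtain J where J: "J \<in> nsets A (card S)" "x ` J = S" using index[OF S(1)] by blast
    then have J': "J \<subseteq> A" "card J = card S" "finite J" by (auto simp: nsets_def)
    have fS: "finite S" "S \<subseteq> V" "card S \<le> n" "r \<le> card V"
    proof -
      show "finite S" "S \<subseteq> V" using S M finite_subset by auto
      then show "card S \<le> n" using Vn card_mono by metis
      show "r \<le> card V" using card_mono[OF Vn(1) M(1)] M(2) m by linarith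
    qed
    have "x \<notin> dev J" using x(4)[of "card S"] S J(1) by (auto simp: devs_def)
    then have "card (A - J) * ((\<Sum>v\<in>V. g S v) / card V - \<eta>) \<le> (\<Sum>i\<in>A - J. g S (x i))"
      using x(1) by (simp add: dev_def X_def J(2) not_less)
    moreover have "card (A - J) = card M - card S"
      using A J' M by (simp add: card_Diff_subset)
    moreover have "(\<Sum>v\<in>V. g S v) / card V = rel_deg r G S"
    proof -
      have "(\<Sum>v\<in>V. g S v) = (\<Sum>v\<in>V - S. g S v) + (\<Sum>v\<in>S. g S v)"
        using fS Vn by (intro sum.subset_diff) auto
      also have "\<dots> = (\<Sum>v\<in>V - S. rel_deg r G (insert v S)) + card S * rel_deg r G S"
        by (simp add: g_def)
      also have "\<dots> = real (card V - card S) * rel_deg r G S + card S * rel_deg r G S"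
        using sum_rel_deg_insert[OF G, of S] fS S by (simp add: V_def)
      also have "\<dots> = card V * rel_deg r G S"
        using fS Vn by (simp add: of_nat_diff algebra_simps)
      finally show ?thesis using V(2) Vn by simp
    qed
    moreover have "(\<Sum>i\<in>A - J. g S (x i)) = (\<Sum>v\<in>M - S. rel_deg r G (insert v S))"
    proof -
      have img: "x ` (A - J) = M - S"
        using inj_on_image_set_diff[OF inj, of A J] J J' by (simp add: M_def)
      have "(\<Sum>v\<in>M - S. rel_deg r G (insert v S)) = (\<Sum>v\<in>x ` (A - J). g S v)"
        unfolding img by (intro sum.cong) (auto simp: g_def)
      also have "\<dots> = (\<Sum>i\<in>A - J. g S (x i))"
        using inj inj_on_subset by (subst sum.reindex) (auto intro: inj_on_subset)
      finally show ?thesis by simp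
    qed
    ultimately show ?thesis by simp
  qed
  have "p - real (r - l) * \<eta> \<le> rel_deg r (induced_subgraph G M) S" if S: "S \<in> nsets M l" for S
  proof -
    have S': "S \<subseteq> M" "card S = l" "finite S" using S by (auto simp: nsets_def)
    obtain I where I: "I \<in> nsets A l" "x ` I = S" using index[OF S'(1)] S' by blast
    then have "S \<notin> B" using x(1,3) unfolding hit_def by blast
    then have "p \<le> rel_deg r G S" using S' M by (auto simp: B_def nsets_def)
    moreover have "rel_deg r G S - real (r - card S) * \<eta> \<le> rel_deg r (induced_subgraph G M) S"
      using rel_deg_induced_ge[OF G, of M l \<eta> S] M avg m S' by (simp add: V_def)
    ultimately show ?thesis using S' by simp
  qed
  then show ?thesis using M by (auto simp: V_def)
qed

section \<open>Minimum degrees and Turan degrees\<close>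

lemma min_deg_le: "finite (verts G) \<Longrightarrow> S \<in> nsets (verts G) l \<Longrightarrow> min_deg l G \<le> deg G S"
  by (simp add: min_deg_def finite_imp_finite_nsets)

lemma nsets_nonempty: "finite V \<Longrightarrow> l \<le> card V \<Longrightarrow> nsets V l \<noteq> {}"
  by (metis card_nsets card.empty binomial_eq_0_iff not_less)

lemma min_deg_attained:
  assumes "finite (verts G)" "l \<le> card (verts G)"
  obtains S where "S \<in> nsets (verts G) l" "min_deg l G = deg G S"
proof -
  have "min_deg l G \<in> deg G ` nsets (verts G) l"
    unfolding min_deg_def using assms nsets_nonempty
    by (intro Min_in finite_imageI finite_imp_finite_nsets) auto
  then show ?thesis using that by auto
qed

lemma min_deg_le_choose:
  assumes "rgraph r G" "l \<le> card (verts G)"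
  shows "min_deg l G \<le> (card (verts G) - l) choose (r - l)"
proof -
  obtain S where "S \<in> nsets (verts G) l" "min_deg l G = deg G S"
    using assms min_deg_attained by (metis rgraph_def)
  then show ?thesis using deg_le_choose[OF assms(1), of S] by (simp add: nsets_def)
qed

abbreviation edgeless :: "nat \<Rightarrow> nat hypergraph" where
  "edgeless n \<equiv> \<lparr>verts = {..<n}, edges = {}\<rparr>"

lemma rgraph_edgeless: "rgraph r (edgeless n)"
  by (simp add: rgraph_def)

lemma family_free_edgeless:
  assumes "\<And>H. H \<in> F \<Longrightarrow> edges H \<noteq> {}"
  shows "family_free r F (edgeless n)"
  using assms by (fastforce simp: family_free_def subgraph_def isomorphic_def)

lemma finite_min_degs:
  assumes "l \<le> n"
  shows "finite {min_deg l G | G :: nat hypergraph.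
           rgraph r G \<and> card (verts G) = n \<and> family_free r F G}"
  by (rule finite_subset[of _ "{..(n - l) choose (r - l)}"])
    (use assms min_deg_le_choose in auto)

lemma min_deg_le_turan_deg:
  fixes G :: "nat hypergraph"
  assumes "rgraph r G" "family_free r F G" "l \<le> card (verts G)"
  shows "min_deg l G \<le> turan_deg r l F (card (verts G))"
  unfolding turan_deg_def using assms by (intro Max_ge finite_min_degs) auto

lemma extremal_graph:
  assumes "\<And>H. H \<in> F \<Longrightarrow> edges H \<noteq> {}" "l \<le> n"
  obtains G :: "nat hypergraph" where "rgraph r G" "card (verts G) = n" "family_free r F G"
    "min_deg l G = turan_deg r l F n"
proof -
  let ?D = "{min_deg l G | G :: nat hypergraph.
           rgraph r G \<and> card (verts G) = n \<and> family_free r F G}"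
  have "min_deg l (edgeless n) \<in> ?D"
    using rgraph_edgeless family_free_edgeless[of F] assms(1)
    by (intro CollectI exI[of _ "edgeless n"]) auto
  then have "Max ?D \<in> ?D" using finite_min_degs[OF assms(2)] by (intro Max_in) blast+
  then show ?thesis using that unfolding turan_deg_def by auto
qed

lemma eps_min_deg_ge_minimum:
  assumes "\<And>S. S \<in> nsets (verts G) l \<Longrightarrow> d \<le> deg G S"
  shows "enat d \<le> eps_min_deg l 0 G"
proof -
  have "card {S \<in> nsets (verts G) l. \<not> d \<le> deg G S} = 0"
    using assms by (metis (mono_tags, lifting) card.empty empty_Collect_eq)
  then show ?thesis unfolding eps_min_deg_def by (intro Sup_upper CollectI exI[of _ d] conjI refl) linarith
qed

text \<open>Every value below a supremum in \<^typ>\<open>enat\<close> is exceeded by an admissible \<open>d\<close>, and degrees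
  are integers; hence the real bound \<open>P\<close>, which need not be an integer, can be used directly as a
  threshold.\<close>

lemma card_low_degree_le:
  fixes \<epsilon> P :: real
  assumes "finite (verts G)" "0 \<le> \<epsilon>" "ereal P \<le> ereal_of_enat (eps_min_deg l \<epsilon> G)"
  shows "real (card {S \<in> nsets (verts G) l. real (deg G S) < P}) \<le> \<epsilon> * (card (verts G) choose l)"
proof (cases "P \<le> 0")
  case True
  then have "{S \<in> nsets (verts G) l. real (deg G S) < P} = {}" by auto
  then show ?thesis using assms(2) by (metis card.empty mult_nonneg_nonneg of_nat_0 of_nat_0_le_iff)
next
  case False
  define k where "k = nat \<lceil>P\<rceil> - 1"
  have k: "real k < P" "P \<le> real (Suc k)" using False by (auto simp: k_def) linarith+
  have "ereal_of_enat (enat k) < ereal_of_enat (eps_min_deg l \<epsilon> G)"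
    using k assms(3) by (metis ereal_of_enat_simps(1) less_ereal.simps(1) order_less_le_trans)
  then have "enat k < eps_min_deg l \<epsilon> G" by (simp only: ereal_of_enat_less_iff)
  then obtain d where d: "k < d"
      "real (card {S \<in> nsets (verts G) l. \<not> d \<le> deg G S}) \<le> \<epsilon> * (card (verts G) choose l)"
    unfolding eps_min_deg_def less_Sup_iff by auto
  have "{S \<in> nsets (verts G) l. real (deg G S) < P} \<subseteq> {S \<in> nsets (verts G) l. \<not> d \<le> deg G S}"
    using d(1) k(2) by fastforce
  then have "card {S \<in> nsets (verts G) l. real (deg G S) < P} \<le> card {S \<in> nsets (verts G) l. \<not> d \<le> deg G S}"
    using assms(1) by (intro card_mono) (simp_all add: finite_imp_finite_nsets)
  then show ?thesis using d(2) by linarith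
qed

section \<open>Comparing the two densities\<close>

definition rel_turan_deg :: "nat \<Rightarrow> nat \<Rightarrow> 'a hypergraph set \<Rightarrow> nat \<Rightarrow> real" where
  "rel_turan_deg r l F n = real (turan_deg r l F n) / real ((n - l) choose (r - l))"

text \<open>The substantial inequality. First \<open>m\<close> is taken so large that the Chernoff terms sum to less
  than \<open>1/2\<close>; only then a member \<open>G n\<close> of the sequence is chosen, so large compared with \<open>m\<close> that
  with probability more than \<open>1/2\<close> the sample avoids repetitions and \<open>l\<close>-sets of low degree. The
  resulting induced subgraph on \<open>m\<close> vertices competes in the definition of \<open>turan_deg\<close>.\<close>

lemma rel_turan_deg_ge_seq_density:
  fixes G :: "nat \<Rightarrow> nat hypergraph" and e p :: real
  assumes l: "l < r" and G: "rl_sequence r l G" "\<And>n. family_free r F (G n)"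
    and p: "has_seq_density r l G p" and e: "0 < e"
  shows "eventually (\<lambda>m. p - e \<le> rel_turan_deg r l F m) sequentially"
proof -
  define \<eta> where "\<eta> = min 1 (e / r)"
  have \<eta>: "0 < \<eta>" "\<eta> \<le> 1" "real (r - l) * \<eta> \<le> e"
  proof -
    have "real (r - l) * \<eta> \<le> real r * (e / real r)"
      using l e by (intro mult_mono) (auto simp: \<eta>_def)
    then show "real (r - l) * \<eta> \<le> e" using l by simp
  qed (use l e in \<open>auto simp: \<eta>_def\<close>)
  obtain \<epsilon> where \<epsilon>: "\<And>n. 0 \<le> \<epsilon> n" "\<epsilon> \<longlonglongrightarrow> 0"
      "\<And>n. ereal (p * real ((card (verts (G n)) - l) choose (r - l))) \<le> ereal_of_enat (eps_min_deg l (\<epsilon> n) (G n))"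
    using p unfolding has_seq_density_def by blast
  have Gn: "rgraph r (G n)" for n using G(1) by (simp add: rl_sequence_def)
  have lim: "filterlim (\<lambda>n. card (verts (G n))) at_top sequentially"
    using G(1) by (simp add: rl_sequence_def)
  have "(\<lambda>m. \<Sum>j\<in>{l..<r}. real m ^ j * exp (- (\<eta>\<^sup>2 / 4) * (real m - real j))) \<longlonglongrightarrow> 0"
    using \<eta> by (intro tendsto_null_sum power_times_exp_decay_tendsto_0) auto
  then have "eventually (\<lambda>m. (\<Sum>j\<in>{l..<r}. real m ^ j * exp (- (\<eta>\<^sup>2 / 4) * (real m - real j))) < 1/2) sequentially"
    by (rule order_tendstoD) simp
  then show ?thesis using eventually_ge_at_top[of r]
  proof eventually_elim
    case (elim m)
    have "filterlim (\<lambda>n. real (card (verts (G n)))) at_top sequentially"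
      using filterlim_compose[OF filterlim_real_sequentially lim] .
    then have "(\<lambda>n. real m ^ 2 / real (card (verts (G n)))) \<longlonglongrightarrow> 0"
      by (rule real_tendsto_divide_at_top[OF tendsto_const])
    moreover have "(\<lambda>n. real m ^ l * (real l ^ l * \<epsilon> n)) \<longlonglongrightarrow> 0"
      using \<epsilon>(2) by (intro tendsto_mult_right_zero)
    ultimately have "(\<lambda>n. real m ^ 2 / real (card (verts (G n))) + real m ^ l * (real l ^ l * \<epsilon> n)) \<longlonglongrightarrow> 0"
      using tendsto_add by fastforce
    then have "eventually (\<lambda>n. real m ^ 2 / real (card (verts (G n))) + real m ^ l * (real l ^ l * \<epsilon> n) < 1/2) sequentially"
      by (rule order_tendstoD) simp
    moreover have "eventually (\<lambda>n. r \<le> card (verts (G n))) sequentially"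
      using lim by (simp add: filterlim_at_top)
    ultimately obtain n where n: "r \<le> card (verts (G n))"
        "real m ^ 2 / real (card (verts (G n))) + real m ^ l * (real l ^ l * \<epsilon> n) < 1/2"
      using eventually_happens'[OF sequentially_bot eventually_conj] by blast
    have fin: "finite (verts (G n))" using Gn by (simp add: rgraph_def)
    have "rel_deg r (G n) S < p \<longleftrightarrow> real (deg (G n) S) < p * real ((card (verts (G n)) - l) choose (r - l))"
      if "S \<in> nsets (verts (G n)) l" for S
    proof -
      have "0 < (card (verts (G n)) - l) choose (r - l)" using n(1) by (simp add: diff_le_mono)
      then show ?thesis using that by (simp add: rel_deg_def nsets_def divide_less_eq)
    qed
    then have "card {S \<in> nsets (verts (G n)) l. rel_deg r (G n) S < p} \<le> \<epsilon> n * (card (verts (G n)) choose l)"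
      using card_low_degree_le[OF fin \<epsilon>(1)[of n] \<epsilon>(3)[of n]] by (simp cong: conj_cong)
    moreover have "0 < card (verts (G n))" "l \<le> r" using n(1) l by auto
    moreover have "real m ^ 2 / real (card (verts (G n))) + real m ^ l * (real l ^ l * \<epsilon> n)
        + (\<Sum>j\<in>{l..<r}. real m ^ j * exp (- (\<eta>\<^sup>2 / 4) * (real m - real j))) < 1"
      using n(2) elim(1) by linarith
    ultimately have "\<exists>M\<subseteq>verts (G n). card M = m \<and>
        (\<forall>S\<in>nsets M l. p - real (r - l) * \<eta> \<le> rel_deg r (induced_subgraph (G n) M) S)"
      using elim(2) \<epsilon>(1) \<eta>(1,2) Gn by (intro exists_induced_subgraph_min_rel_deg[OF _ refl]) auto
    then obtain M where M: "M \<subseteq> verts (G n)" "card M = m"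
        "\<And>S. S \<in> nsets M l \<Longrightarrow> p - real (r - l) * \<eta> \<le> rel_deg r (induced_subgraph (G n) M) S"
      by blast
    have rg: "rgraph r (induced_subgraph (G n) M)" using rgraph_induced[OF Gn M(1)] .
    then obtain S where S: "S \<in> nsets M l" "min_deg l (induced_subgraph (G n) M) = deg (induced_subgraph (G n) M) S"
      using min_deg_attained[of "induced_subgraph (G n) M" l] M(2) elim l by (auto simp: rgraph_def)
    have "p - e \<le> rel_deg r (induced_subgraph (G n) M) S" using M(3)[OF S(1)] \<eta>(3) by linarith
    also have "\<dots> = min_deg l (induced_subgraph (G n) M) / real ((m - l) choose (r - l))"
      using S M(2) by (simp add: rel_deg_def nsets_def)
    also have "\<dots> \<le> rel_turan_deg r l F m"
      unfolding rel_turan_deg_def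
      using min_deg_le_turan_deg[OF rg family_free_induced[OF G(2) M(1)], of l] M(2) elim l
      by (intro divide_right_mono) auto
    finally show ?case .
  qed
qed

lemma rel_turan_deg_le_1:
  assumes "\<And>H. H \<in> F \<Longrightarrow> edges H \<noteq> {}" "l \<le> n"
  shows "rel_turan_deg r l F n \<le> 1"
proof -
  obtain G :: "nat hypergraph" where "rgraph r G" "card (verts G) = n" "min_deg l G = turan_deg r l F n"
    using extremal_graph[OF assms] by metis
  then show ?thesis
    using min_deg_le_choose[of r G l] assms(2) by (simp add: rel_turan_deg_def divide_le_eq)
qed

lemma seq_densities_bdd: "bdd_above {p. has_seq_density r l G p}"
  by (auto simp: bdd_above_def has_seq_density_def)

lemma turan_density_star_bdd:
  "bdd_above {seq_density r l G | G :: nat \<Rightarrow> nat hypergraph.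
            rl_sequence r l G \<and> (\<forall>n. family_free r F (G n))}"
proof (rule bdd_aboveI, clarify)
  fix G :: "nat \<Rightarrow> nat hypergraph" assume "rl_sequence r l G"
  then show "seq_density r l G \<le> 1"
    unfolding seq_density_def by (intro cSup_least) (auto simp: rl_sequence_def has_seq_density_def)
qed

lemma le_turan_density_star:
  fixes G :: "nat \<Rightarrow> nat hypergraph"
  assumes "rl_sequence r l G" "\<And>n. family_free r F (G n)" "has_seq_density r l G p"
  shows "p \<le> turan_density_star r l F"
proof -
  have "p \<le> seq_density r l G"
    unfolding seq_density_def using assms(3) seq_densities_bdd by (intro cSup_upper) auto
  also have "\<dots> \<le> turan_density_star r l F"
    unfolding turan_density_star_def using assms by (intro cSup_upper turan_density_star_bdd) auto
  finally show ?thesis .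
qed

text \<open>The easy inequality: extremal graphs along a subsequence form an \<open>(r,l)\<close>-sequence with all
  \<open>\<epsilon>\<^sub>n = 0\<close>. Only infinitely many \<open>n\<close> are needed, so this bounds the limit superior of the
  normalised Turan degrees before their limit is known to exist.\<close>

lemma turan_density_star_ge_frequent:
  fixes q :: real
  assumes F: "\<And>H. H \<in> F \<Longrightarrow> edges H \<noteq> {}" and "l < r" "0 \<le> q"
    and freq: "frequently (\<lambda>n. q \<le> rel_turan_deg r l F n) sequentially"
  shows "q \<le> turan_density_star r l F"
proof -
  have "\<exists>n\<ge>max k r. q \<le> rel_turan_deg r l F n" for k
    using freq unfolding frequently_sequentially by blast
  then obtain s where s: "\<And>k. k \<le> s k" "\<And>k. r \<le> s k" "\<And>k. q \<le> rel_turan_deg r l F (s k)"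
    by (metis max.bounded_iff)
  have ls: "l \<le> s k" for k using s(2)[of k] assms(2) by linarith
  have "\<exists>G :: nat hypergraph. rgraph r G \<and> card (verts G) = s k \<and> family_free r F G
      \<and> min_deg l G = turan_deg r l F (s k)" for k
    using extremal_graph[OF F ls] by metis
  then obtain G :: "nat \<Rightarrow> nat hypergraph" where G: "\<And>k. rgraph r (G k)" "\<And>k. card (verts (G k)) = s k"
      "\<And>k. family_free r F (G k)" "\<And>k. min_deg l (G k) = turan_deg r l F (s k)"
    by metis
  have "q \<le> 1" using s(3)[of 0] rel_turan_deg_le_1[of F l "s 0" r, OF F ls] by linarith
  moreover have "ereal (q * real ((card (verts (G k)) - l) choose (r - l))) \<le> ereal_of_enat (eps_min_deg l 0 (G k))" for k
  proof -
    have "0 < (s k - l) choose (r - l)" using s(2)[of k] by (simp add: diff_le_mono)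
    then have "q * real ((s k - l) choose (r - l)) \<le> turan_deg r l F (s k)"
      using s(3)[of k] by (simp add: rel_turan_deg_def le_divide_eq)
    then have "ereal (q * real ((card (verts (G k)) - l) choose (r - l))) \<le> ereal_of_enat (enat (min_deg l (G k)))"
      by (simp add: G)
    also have "\<dots> \<le> ereal_of_enat (eps_min_deg l 0 (G k))"
      unfolding ereal_of_enat_le_iff
      using G(1)[of k] by (intro eps_min_deg_ge_minimum min_deg_le) (simp_all add: rgraph_def)
    finally show ?thesis .
  qed
  ultimately have dens: "has_seq_density r l G q"
    unfolding has_seq_density_def using assms(3) by (intro conjI exI[of _ "\<lambda>_. 0"]) auto
  moreover have "filterlim (\<lambda>n. card (verts (G n))) at_top sequentially"
    unfolding G(2) by (rule filterlim_at_top_mono[OF filterlim_ident]) (simp add: s(1))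
  ultimately show ?thesis using G by (intro le_turan_density_star[of r l G]) (auto simp: rl_sequence_def)
qed

text \<open>Edgeless graphs contain no nonempty graph, so the supremum defining \<open>turan_density_star\<close>
  is over a nonempty set and is nonnegative.\<close>

lemma edgeless_sequence:
  "has_seq_density r l edgeless 0" "rl_sequence r l edgeless"
proof -
  show "has_seq_density r l edgeless 0"
    unfolding has_seq_density_def by (intro conjI exI[of _ "\<lambda>_. 0"]) (auto simp: zero_ereal_def[symmetric])
  then show "rl_sequence r l edgeless"
    using rgraph_edgeless by (auto simp: rl_sequence_def filterlim_ident)
qed

lemma rel_turan_deg_tendsto_turan_density_star:
  assumes F: "\<And>H. H \<in> F \<Longrightarrow> edges H \<noteq> {}" and "l < r"
  shows "rel_turan_deg r l F \<longlonglongrightarrow> turan_density_star r l F"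
proof (rule order_tendstoI)
  fix a assume "a < turan_density_star r l F"
  moreover have "{seq_density r l G | G :: nat \<Rightarrow> nat hypergraph.
            rl_sequence r l G \<and> (\<forall>n. family_free r F (G n))} \<noteq> {}"
    using edgeless_sequence(2) family_free_edgeless[OF F] by blast
  ultimately obtain G :: "nat \<Rightarrow> nat hypergraph" where
      G: "rl_sequence r l G" "\<And>n. family_free r F (G n)" "a < seq_density r l G"
    unfolding turan_density_star_def by (auto simp: less_cSup_iff[OF _ turan_density_star_bdd])
  then obtain p where p: "has_seq_density r l G p" "a < p"
    unfolding seq_density_def rl_sequence_def
    by (subst (asm) less_cSup_iff[OF _ seq_densities_bdd]) auto
  show "eventually (\<lambda>n. a < rel_turan_deg r l F n) sequentially"
    using rel_turan_deg_ge_seq_density[OF assms(2) G(1,2) p(1), of "(p - a) / 2"] p(2)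
    by (auto elim!: eventually_mono simp: field_simps)
next
  fix b assume b: "turan_density_star r l F < b"
  have "0 \<le> turan_density_star r l F"
    using le_turan_density_star[OF edgeless_sequence(2) _ edgeless_sequence(1)] family_free_edgeless[OF F] by blast
  then have "\<not> frequently (\<lambda>n. b \<le> rel_turan_deg r l F n) sequentially"
    using turan_density_star_ge_frequent[OF F assms(2), where q = b] b by fastforce
  then show "eventually (\<lambda>n. rel_turan_deg r l F n < b) sequentially"
    by (simp add: frequently_def not_le)
qed

theorem corollary4:
  fixes r l :: nat and F :: "'a hypergraph set"
  assumes "1 \<le> l" and "l < r"
    and "\<And>H. H \<in> F \<Longrightarrow> rgraph r H \<and> edges H \<noteq> {}"
  shows "turan_density_star r l F = turan_density r l F"
proof -
  have "rel_turan_deg r l F \<longlonglongrightarrow> turan_density_star r l F"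
    using assms by (intro rel_turan_deg_tendsto_turan_density_star) auto
  then show ?thesis
    unfolding turan_density_def rel_turan_deg_def[abs_def] by (rule limI[symmetric])
qed

end
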